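(* Let $\pi$ be a permutation that has at least three left to right maxima, and such that the third left to right maximum of $\pi$ is not the final term of $\pi$. Then $B^{-1}(\mathrm{Av}(\pi))$ is not a pattern class.
   Context: Permutations are sequences of length $n\ge 1$ using each of $1,\ldots,n$ exactly once. For any finite sequence of distinct numbers, the one-pass bubble sort operator $B$ is defined recursively by $B(\epsilon)=\epsilon$ for the empty sequence, and, writing a non-empty sequence as $\sigma=\sigma_1 m\sigma_2$ with $m$ its largest term, $B(\sigma)=B(\sigma_1)\sigma_2 m$. A permutation $\sigma$ is a subpermutation of $\tau$, written $\sigma\preceq\tau$, if $\tau$ has a (not necessarily consecutive) subsequence order isomorphic to $\sigma$. A pattern class is a set of permutations closed downward under $\preceq$. For a set $M$ of permutations, $\mathrm{Av}(M)=\{\beta:\mu\not\preceq\beta \text{ for all } \mu\in M\}$, and $\mathrm{Av}(\pi)=\mathrm{Av}(\{\pi\})$. For a set $X$ of permutations, $B^{-1}(X)=\{\sigma : B(\sigma)\in X\}$. A left to right maximum of a sequence is a term larger than every term preceding it. *)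

theory Defs
  imports Main "HOL-Library.Sublist"
begin

definition is_perm :: "nat list \<Rightarrow> bool" where
  "is_perm \<sigma> \<longleftrightarrow> \<sigma> \<noteq> [] \<and> distinct \<sigma> \<and> set \<sigma> = {1..length \<sigma>}"

text \<open>A non-empty sequence is split at (the first occurrence of) its largest term; for sequences
  of distinct terms, lemma \<open>bubble_split\<close> below gives the defining recursion.\<close>

function bubble :: "'a::linorder list \<Rightarrow> 'a list" where
  "bubble xs =
     (if xs = [] then []
      else let m = Max (set xs)
           in bubble (takeWhile (\<lambda>x. x \<noteq> m) xs) @ tl (dropWhile (\<lambda>x. x \<noteq> m) xs) @ [m])"
  by auto
termination
proof (relation "measure length")
  fix xs :: "'a list" and m
  assume "xs \<noteq> []" and m: "m = Max (set xs)"
  then have "m \<in> set xs" by simp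
  then have "takeWhile (\<lambda>x. x \<noteq> m) xs \<noteq> xs"
    by (metis (full_types) set_takeWhileD)
  then have "length (takeWhile (\<lambda>x. x \<noteq> m) xs) \<noteq> length xs"
    by (metis takeWhile_eq_take take_all order_refl)
  then show "(takeWhile (\<lambda>x. x \<noteq> m) xs, xs) \<in> measure length"
    using length_takeWhile_le[of "\<lambda>x. x \<noteq> m" xs] by simp
qed simp

declare bubble.simps [simp del]

lemma bubble_Nil: "bubble [] = []"
  by (simp add: bubble.simps)

lemma bubble_split:
  assumes "\<And>x. x \<in> set \<sigma>\<^sub>1 \<Longrightarrow> x < m" and "\<And>x. x \<in> set \<sigma>\<^sub>2 \<Longrightarrow> x < m"
  shows "bubble (\<sigma>\<^sub>1 @ m # \<sigma>\<^sub>2) = bubble \<sigma>\<^sub>1 @ \<sigma>\<^sub>2 @ [m]"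
proof -
  let ?xs = "\<sigma>\<^sub>1 @ m # \<sigma>\<^sub>2"
  have mx: "Max (set ?xs) = m"
    by (rule Max_eqI) (use assms in \<open>auto intro: less_imp_le\<close>)
  have ne: "\<forall>x\<in>set \<sigma>\<^sub>1. x \<noteq> m" using assms(1) by blast
  have "takeWhile (\<lambda>x. x \<noteq> m) ?xs = \<sigma>\<^sub>1" "dropWhile (\<lambda>x. x \<noteq> m) ?xs = m # \<sigma>\<^sub>2"
    using ne by (auto simp: takeWhile_append dropWhile_append)
  with mx show ?thesis
    by (subst bubble.simps) (simp only: Let_def, simp)
qed

definition order_iso :: "'a::linorder list \<Rightarrow> 'b::linorder list \<Rightarrow> bool" where
  "order_iso xs ys \<longleftrightarrow> length xs = length ys \<and>
     (\<forall>i<length xs. \<forall>j<length xs. xs ! i < xs ! j \<longleftrightarrow> ys ! i < ys ! j)"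

definition subperm :: "nat list \<Rightarrow> nat list \<Rightarrow> bool" (infix \<open>\<preceq>\<close> 50) where
  "\<sigma> \<preceq> \<tau> \<longleftrightarrow> (\<exists>\<rho>. subseq \<rho> \<tau> \<and> order_iso \<sigma> \<rho>)"

definition pattern_class :: "nat list set \<Rightarrow> bool" where
  "pattern_class C \<longleftrightarrow> (\<forall>\<tau>\<in>C. is_perm \<tau>) \<and>
     (\<forall>\<tau>\<in>C. \<forall>\<sigma>. is_perm \<sigma> \<and> \<sigma> \<preceq> \<tau> \<longrightarrow> \<sigma> \<in> C)"

definition Av :: "nat list set \<Rightarrow> nat list set" where
  "Av M = {\<beta>. is_perm \<beta> \<and> (\<forall>\<mu>\<in>M. \<not> \<mu> \<preceq> \<beta>)}"

definition bubble_preimage :: "nat list set \<Rightarrow> nat list set" where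
  "bubble_preimage X = {\<sigma>. is_perm \<sigma> \<and> bubble \<sigma> \<in> X}"

definition lr_maxima :: "'a::linorder list \<Rightarrow> 'a list" where
  "lr_maxima xs = map ((!) xs) (filter (\<lambda>i. \<forall>j<i. xs ! j < xs ! i) [0..<length xs])"

end

theory Submission
  imports Defs
begin

text \<open>
  Drop the last term of \<open>\<pi>\<close> if it is the maximum, and split the result at the second left to
  right maximum \<open>b\<close> of \<open>\<pi>\<close>, giving \<open>u b v\<close> of length \<open>n\<close>; by hypothesis \<open>v\<close> still has a term
  larger than \<open>b\<close>. Writing \<open>x = n + 1\<close> and \<open>N = n + 2\<close>, bubble sort sends \<open>b u x v\<close> to
  \<open>u b v x\<close>, which contains \<open>\<pi>\<close>. But \<open>b u x v\<close> is contained in \<open>x b u N v\<close>, whose image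
  \<open>b u x v N\<close> avoids \<open>\<pi>\<close>: otherwise deleting one term of \<open>b u x v\<close> would give a
  sequence order isomorphic to \<open>u b v\<close>. If the term deleted lies in \<open>b u\<close>, then \<open>x\<close>, the maximum,
  takes the position of \<open>b\<close>, which is not the maximum of \<open>u b v\<close>; otherwise the first term \<open>b\<close>
  exceeds the last term of \<open>u\<close>, which takes the position of \<open>b\<close>.
\<close>

lemma subseq_delete_one:
  assumes "subseq xs ys" and "length ys = Suc (length xs)"
  shows "\<exists>k<length ys. xs = take k ys @ drop (Suc k) ys"
  using assms
proof (induction rule: list_emb.induct)
  case (list_emb_Nil ys)
  then show ?case by (cases ys) auto
next
  case (list_emb_Cons xs ys y)
  then have "xs = ys"
    by (intro subseq_same_length) auto
  then show ?case by (intro exI[of _ 0]) simp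
next
  case (list_emb_Cons2 x y xs ys)
  from list_emb_Cons2.prems have "length ys = Suc (length xs)" by simp
  then obtain k where "k < length ys" "xs = take k ys @ drop (Suc k) ys"
    using list_emb_Cons2.IH by blast
  with \<open>x = y\<close> show ?case by (intro exI[of _ "Suc k"]) simp
qed

lemma nth_take_drop_Suc:
  assumes "k < length xs" and "Suc i < length xs"
  shows "(take k xs @ drop (Suc k) xs) ! i = (if i < k then xs ! i else xs ! Suc i)"
  using assms by (auto simp: nth_append)

lemma not_subperm_move_front:
  assumes "u \<noteq> []" and ub: "\<And>y. y \<in> set u \<Longrightarrow> y < b"
    and "c \<in> set v" and "b < c" and vx: "\<And>y. y \<in> set v \<Longrightarrow> y < x"
  shows "\<not> (u @ b # v) \<preceq> (b # u @ x # v)"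
proof
  let ?p = "u @ b # v" and ?w = "b # u @ x # v"
  assume "?p \<preceq> ?w"
  then obtain \<rho> where sub: "subseq \<rho> ?w" and len: "length \<rho> = length ?p"
    and iso: "\<And>i j. i < length ?p \<Longrightarrow> j < length ?p \<Longrightarrow> ?p ! i < ?p ! j \<longleftrightarrow> \<rho> ! i < \<rho> ! j"
    unfolding subperm_def order_iso_def by auto
  from len have "length ?w = Suc (length \<rho>)" by simp
  with sub obtain k where k: "k < length ?w" and \<rho>: "\<rho> = take k ?w @ drop (Suc k) ?w"
    using subseq_delete_one by blast
  have nth: "\<rho> ! i = (if i < k then ?w ! i else ?w ! Suc i)" if "i < length ?p" for i
    using nth_take_drop_Suc[OF k, of i] that k unfolding \<rho> by simp
  \<comment> \<open>The index \<open>k\<close> is the position deleted from \<open>?w\<close>, and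
    \<open>k \<le> length u\<close> says that it lies in \<open>b # u\<close>. In that case
    everything behind it moves one place to the left and \<open>x\<close> lands at index
    \<open>length u\<close>, where \<open>?p\<close> has \<open>b\<close>; otherwise the indices
    from \<open>0\<close> to \<open>length u\<close> are unaffected.\<close>
  show False
  proof (cases "k \<le> length u")
    case True
    obtain l where l: "l < length v" "v ! l = c"
      using \<open>c \<in> set v\<close> by (auto simp: in_set_conv_nth)
    let ?j = "Suc (length u + l)"
    have "?p ! length u < ?p ! ?j"
      using l \<open>b < c\<close> by (simp add: nth_append)
    then have "\<rho> ! length u < \<rho> ! ?j"
      using iso[of "length u" ?j] l by simp
    moreover have "\<rho> ! length u = x" "\<rho> ! ?j = c"
      using True l nth[of "length u"] nth[of ?j] by (auto simp: nth_append)
    ultimately show False using vx[of c] \<open>c \<in> set v\<close> by simp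
  next
    case False
    have "?p ! 0 < ?p ! length u"
      using \<open>u \<noteq> []\<close> ub by (simp add: nth_append)
    then have "\<rho> ! 0 < \<rho> ! length u"
      using iso[of 0 "length u"] by simp
    moreover have "\<rho> ! 0 = b" "\<rho> ! length u = last u"
      using False \<open>u \<noteq> []\<close> nth[of 0] nth[of "length u"]
      by (auto simp: nth_append nth_Cons' last_conv_nth)
    ultimately show False using ub[of "last u"] \<open>u \<noteq> []\<close> by simp
  qed
qed

lemma subseq_snoc_cases:
  assumes "subseq ys (xs @ [m])"
  obtains "subseq ys xs" | zs where "ys = zs @ [m]" "subseq zs xs"
proof -
  obtain us vs where "ys = us @ vs" "subseq us xs" "subseq vs [m]"
    using assms by (auto simp: subseq_append_iff)
  moreover from \<open>subseq vs [m]\<close> have "vs = [] \<or> vs = [m]"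
    by (cases vs) (auto simp: subseq_Cons' split: if_splits)
  ultimately show thesis using that by auto
qed

text \<open>A copy of \<open>p\<close> that used \<open>m\<close> would have its largest term in
  final place, whereas \<open>z\<close> exceeds the last term of \<open>p\<close>. So the copy lies
  within \<open>w\<close>.\<close>

lemma subperm_snoc_max:
  assumes "p \<preceq> w @ [m]" and "\<And>y. y \<in> set w \<Longrightarrow> y < m"
    and "z \<in> set p" and "last p < z"
  shows "p \<preceq> w"
proof -
  obtain \<rho> where sub: "subseq \<rho> (w @ [m])" and iso: "order_iso p \<rho>"
    using assms(1) unfolding subperm_def by blast
  from sub show ?thesis
  proof (cases rule: subseq_snoc_cases)
    case 1
    with iso show ?thesis unfolding subperm_def by auto
  next
    case (2 \<rho>')
    obtain i where i: "i < length p" "p ! i = z"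
      using assms(3) by (auto simp: in_set_conv_nth)
    have "p \<noteq> []" using assms(3) by auto
    then have "p ! (length p - 1) < p ! i"
      using assms(4) i by (simp add: last_conv_nth)
    then have less: "\<rho> ! (length p - 1) < \<rho> ! i"
      using iso i unfolding order_iso_def by auto
    have len: "length p = Suc (length \<rho>')"
      using iso 2(1) unfolding order_iso_def by simp
    have "\<rho> ! i \<in> set \<rho>"
      using i(1) len 2(1) by (intro nth_mem) simp
    moreover have "set \<rho>' \<subseteq> set w"
      using 2(2) by (auto elim: list_emb_set)
    ultimately have "\<rho> ! i \<le> m"
      using assms(2) 2(1) by (auto intro: less_imp_le)
    with less len 2(1) show ?thesis by simp
  qed
qed

text \<open>All terms but the last of a subsequence of \<open>w @ [m]\<close> come from
  \<open>w\<close>, so cutting the end off a copy of \<open>p @ [z]\<close> leaves a copy of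
  \<open>p\<close> in \<open>w\<close>.\<close>

lemma subperm_snoc_snoc:
  assumes "p @ [z] \<preceq> w @ [m]"
  shows "p \<preceq> w"
proof -
  obtain \<rho> where sub: "subseq \<rho> (w @ [m])" and iso: "order_iso (p @ [z]) \<rho>"
    using assms unfolding subperm_def by blast
  then have len: "length \<rho> = Suc (length p)" unfolding order_iso_def by simp
  from sub have "subseq (butlast \<rho>) w"
  proof (cases rule: subseq_snoc_cases)
    case 1
    have "subseq (butlast \<rho>) \<rho>" by (simp add: prefixeq_butlast prefix_imp_subseq)
    then show ?thesis using 1 by (rule subseq_order.order_trans)
  qed simp
  moreover have "order_iso p (butlast \<rho>)"
    unfolding order_iso_def
  proof (intro conjI allI impI)
    show "length p = length (butlast \<rho>)" using len by simp
    fix i j assume "i < length p" "j < length p"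
    moreover from this have "(p @ [z]) ! i < (p @ [z]) ! j \<longleftrightarrow> \<rho> ! i < \<rho> ! j"
      using iso unfolding order_iso_def by simp
    ultimately show "p ! i < p ! j \<longleftrightarrow> butlast \<rho> ! i < butlast \<rho> ! j"
      using len by (simp add: nth_append nth_butlast)
  qed
  ultimately show ?thesis unfolding subperm_def by blast
qed

lemma subperm_append: "p \<preceq> p @ q"
  unfolding subperm_def order_iso_def by (intro exI[of _ p]) auto

text \<open>Raising the maximum alters no comparison, and the additional front term \<open>x\<close>
  is skipped.\<close>

lemma subperm_raise_max:
  assumes "\<And>y. y \<in> set u \<union> set v \<Longrightarrow> y < m" and "m \<le> m'"
  shows "u @ m # v \<preceq> x # u @ m' # v"
  unfolding subperm_def
proof (intro exI[of _ "u @ m' # v"] conjI)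
  show "order_iso (u @ m # v) (u @ m' # v)"
    unfolding order_iso_def
  proof (intro conjI allI impI)
    fix i j assume "i < length (u @ m # v)" "j < length (u @ m # v)"
    moreover have "y < m \<and> y < m' \<and> \<not> m < y \<and> \<not> m' < y" if "y \<in> set u \<union> set v" for y
      using that assms by fastforce
    ultimately show "(u @ m # v) ! i < (u @ m # v) ! j \<longleftrightarrow> (u @ m' # v) ! i < (u @ m' # v) ! j"
      by (auto simp: nth_append nth_Cons')
  qed simp
qed auto

text \<open>This serves both the case where \<open>u @ b # v\<close> is \<pi> and the case where it
  is \<pi> without a final maximum. The two cases enter only through \<open>contains\<close>, which
  puts \<pi> into the image of \<sigma>, and \<open>reduce\<close>, which strips the final
  \<open>N\<close> from the image of \<tau>.\<close>

lemma not_pattern_class_bubble_preimage: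
  assumes perm: "is_perm (u @ b # v)"
    and "u \<noteq> []" and ub: "\<And>y. y \<in> set u \<Longrightarrow> y < b"
    and c: "c \<in> set v" "b < c"
    and contains: "\<pi> \<preceq> u @ b # v @ [Suc (length (u @ b # v))]"
    and reduce: "\<And>w m. (\<And>y. y \<in> set w \<Longrightarrow> y < m) \<Longrightarrow> \<pi> \<preceq> w @ [m] \<Longrightarrow> u @ b # v \<preceq> w"
  shows "\<not> pattern_class (bubble_preimage (Av {\<pi>}))"
proof
  assume cls: "pattern_class (bubble_preimage (Av {\<pi>}))"
  define n where "n = length (u @ b # v)"
  define x where "x = Suc n"
  define N where "N = Suc x"
  have set_p: "set u \<union> insert b (set v) = {1..n}" and dist: "distinct (u @ b # v)"
    using perm unfolding is_perm_def n_def by auto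
  have below: "y < x" if "y \<in> set u \<union> insert b (set v)" for y
    using that unfolding set_p x_def by auto
  have len: "length u + length v = n - 1" "n > 0" unfolding n_def by auto
  define \<sigma> where "\<sigma> = b # u @ x # v"
  define \<tau> where "\<tau> = x # b # u @ N # v"
  \<comment> \<open>The largest term of \<sigma> is \<open>x\<close>, and that of the prefix
    \<open>b # u\<close> is \<open>b\<close>, so the recursion is unfolded at each of these.\<close>
  have B\<sigma>: "bubble \<sigma> = u @ b # v @ [x]"
    using bubble_split[of "b # u" x v] bubble_split[of "[]" b u] below ub
    by (auto simp: \<sigma>_def bubble_Nil)
  have B\<tau>: "bubble \<tau> = (b # u @ x # v) @ [N]"
  proof -
    have "bubble (x # b # u) = b # u @ [x]"
      using bubble_split[of "[]" x "b # u"] below by (auto simp: bubble_Nil)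
    moreover have "bubble ((x # b # u) @ N # v) = bubble (x # b # u) @ v @ [N]"
      by (rule bubble_split) (use below in \<open>auto simp: N_def less_Suc_eq\<close>)
    ultimately show ?thesis by (simp add: \<tau>_def)
  qed
  have xN: "x \<notin> set u \<union> insert b (set v)" "N \<notin> set u \<union> insert b (set v)"
    unfolding set_p x_def N_def by auto
  have sets: "insert x (set u \<union> insert b (set v)) = {1..Suc n}"
    "insert N (insert x (set u \<union> insert b (set v))) = {1..Suc (Suc n)}"
    unfolding set_p x_def N_def by auto
  have perm_\<sigma>: "is_perm \<sigma>"
    using dist xN sets len unfolding is_perm_def \<sigma>_def
    by (auto simp: insert_commute)
  have "is_perm \<tau>" "is_perm (bubble \<tau>)"
    using dist xN sets len unfolding is_perm_def \<tau>_def B\<tau>[unfolded \<tau>_def]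
    by (auto simp: insert_commute N_def)
  moreover have "\<not> \<pi> \<preceq> bubble \<tau>"
  proof
    assume "\<pi> \<preceq> bubble \<tau>"
    then have "u @ b # v \<preceq> b # u @ x # v"
      unfolding B\<tau> using below by (intro reduce) (auto simp: N_def less_Suc_eq)
    then show False
      using not_subperm_move_front[of u b c v x] \<open>u \<noteq> []\<close> ub c below by auto
  qed
  ultimately have "\<tau> \<in> bubble_preimage (Av {\<pi>})"
    unfolding bubble_preimage_def Av_def by simp
  moreover have "\<sigma> \<preceq> \<tau>"
    using subperm_raise_max[of "b # u" v x N x] below unfolding \<sigma>_def \<tau>_def N_def by auto
  ultimately have "\<sigma> \<in> bubble_preimage (Av {\<pi>})"
    using cls perm_\<sigma> unfolding pattern_class_def by blast
  moreover have "\<pi> \<preceq> bubble \<sigma>"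
    using contains B\<sigma> unfolding x_def n_def by simp
  ultimately show False
    unfolding bubble_preimage_def Av_def by simp
qed

text \<open>The indices \<open>i\<close> and \<open>j\<close> are the positions of the second and
  third left to right maxima. The list of such positions is strictly increasing, and the first of
  them, lying below \<open>i\<close>, gives \<open>0 < i\<close>.\<close>

lemma lr_maxima_nth_1_2:
  assumes "length (lr_maxima xs) \<ge> 3"
  obtains i j where "0 < i" "i < j" "j < length xs" "xs ! j = lr_maxima xs ! 2"
    "\<And>k. k < i \<Longrightarrow> xs ! k < xs ! i" "xs ! i < xs ! j"
proof -
  let ?P = "\<lambda>i. \<forall>j<i. xs ! j < xs ! i"
  let ?F = "filter ?P [0..<length xs]"
  have len: "length ?F \<ge> 3" and nth2: "lr_maxima xs ! 2 = xs ! (?F ! 2)"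
    using assms unfolding lr_maxima_def by auto
  have "sorted_wrt (<) ?F" by (simp add: sorted_wrt_filter)
  then have lt: "?F ! 0 < ?F ! 1" "?F ! 1 < ?F ! 2"
    using len sorted_wrt_nth_less[of _ ?F 0 1] sorted_wrt_nth_less[of _ ?F 1 2] by auto
  have "?F ! 1 \<in> set ?F" "?F ! 2 \<in> set ?F"
    using len by (auto intro!: nth_mem simp del: set_filter)
  then have "?P (?F ! 1)" "?P (?F ! 2)" "?F ! 2 < length xs" by auto
  with lt nth2 show thesis by (intro that[of "?F ! 1" "?F ! 2"]) auto
qed

theorem theorem2p1:
  fixes \<pi> :: "nat list"
  assumes "is_perm \<pi>"
    and "length (lr_maxima \<pi>) \<ge> 3"
    and "lr_maxima \<pi> ! 2 \<noteq> last \<pi>"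
  shows "\<not> pattern_class (bubble_preimage (Av {\<pi>}))"
proof -
  obtain i j where ij: "0 < i" "i < j" "j < length \<pi>" "\<pi> ! j = lr_maxima \<pi> ! 2"
    "\<And>k. k < i \<Longrightarrow> \<pi> ! k < \<pi> ! i" "\<pi> ! i < \<pi> ! j"
    using lr_maxima_nth_1_2[OF assms(2)] by blast
  have "\<pi> \<noteq> []" and dist: "distinct \<pi>" and set: "set \<pi> = {1..length \<pi>}"
    using assms(1) unfolding is_perm_def by auto
  \<comment> \<open>Strictness here keeps the third left to right maximum in place when the last
    term is dropped.\<close>
  have j: "j < length \<pi> - 1"
    using ij(3,4) assms(3) \<open>\<pi> \<noteq> []\<close> by (cases "j = length \<pi> - 1") (auto simp: last_conv_nth)
  \<comment> \<open>Here \<open>p\<close> stands for \<pi> or \<open>butlast \<pi>\<close>, which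
    agree up to index \<open>j\<close>.\<close>
  have split: "\<exists>u v. p = u @ \<pi> ! i # v \<and> u \<noteq> [] \<and> (\<forall>y\<in>set u. y < \<pi> ! i) \<and> \<pi> ! j \<in> set v"
    if "j < length p" "\<And>k. k \<le> j \<Longrightarrow> p ! k = \<pi> ! k" for p
  proof (intro exI conjI ballI)
    show "p = take i p @ \<pi> ! i # drop (Suc i) p"
      using that ij(2) id_take_nth_drop[of i p] by simp
    show "take i p \<noteq> []" using that ij(1) by auto
    show "y < \<pi> ! i" if "y \<in> set (take i p)" for y
      using that \<open>\<And>k. k \<le> j \<Longrightarrow> p ! k = \<pi> ! k\<close> ij(2,5) by (auto simp: in_set_conv_nth)
    have "drop (Suc i) p ! (j - Suc i) = \<pi> ! j" "j - Suc i < length (drop (Suc i) p)"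
      using that ij(2) by auto
    then show "\<pi> ! j \<in> set (drop (Suc i) p)" by (metis nth_mem)
  qed
  show ?thesis
  proof (cases "last \<pi> = length \<pi>")
    case True
    let ?p = "butlast \<pi>"
    have eq: "\<pi> = ?p @ [length \<pi>]" using True \<open>\<pi> \<noteq> []\<close> by (metis append_butlast_last_id)
    obtain u v where uv: "?p = u @ \<pi> ! i # v" "u \<noteq> []" "\<forall>y\<in>set u. y < \<pi> ! i" "\<pi> ! j \<in> set v"
      using split[of ?p] j by (auto simp: nth_butlast)
    have "set ?p = {1..length \<pi>} - {length \<pi>}"
    proof -
      have "set (?p @ [length \<pi>]) = {1..length \<pi>}" "distinct (?p @ [length \<pi>])"
        using eq set dist by metis+
      then show ?thesis by auto
    qed
    also have "\<dots> = {1..length ?p}" by auto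
    finally have "is_perm ?p"
      using distinct_butlast[OF dist] uv(1) unfolding is_perm_def by simp
    then have perm: "is_perm (u @ \<pi> ! i # v)" using uv(1) by simp
    have "Suc (length ?p) = length \<pi>" using \<open>\<pi> \<noteq> []\<close> by simp
    then have "\<pi> = u @ \<pi> ! i # v @ [Suc (length (u @ \<pi> ! i # v))]"
      using eq uv(1) by (metis append.assoc append_Cons)
    then have contains: "\<pi> \<preceq> u @ \<pi> ! i # v @ [Suc (length (u @ \<pi> ! i # v))]"
      using subperm_append[of \<pi> "[]"] by simp
    show ?thesis
    proof (rule not_pattern_class_bubble_preimage[OF perm uv(2) _ uv(4) ij(6) contains])
      fix w m assume "\<pi> \<preceq> w @ [m]"
      then show "u @ \<pi> ! i # v \<preceq> w"
        using subperm_snoc_snoc eq uv(1) by metis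
    qed (use uv(3) in blast)
  next
    case False
    obtain u v where uv: "\<pi> = u @ \<pi> ! i # v" "u \<noteq> []" "\<forall>y\<in>set u. y < \<pi> ! i" "\<pi> ! j \<in> set v"
      using split[of \<pi>] ij(3) by auto
    \<comment> \<open>The value \<open>length \<pi>\<close> occurs before the end of \<pi>, so it
      can play the part of \<open>z\<close> in \<open>subperm_snoc_max\<close>.\<close>
    have "last \<pi> \<in> {1..length \<pi>}" using \<open>\<pi> \<noteq> []\<close> set last_in_set by blast
    with False have max: "length \<pi> \<in> set \<pi>" "last \<pi> < length \<pi>"
      unfolding set by auto
    have perm: "is_perm (u @ \<pi> ! i # v)" using assms(1) uv(1) by simp
    have contains: "\<pi> \<preceq> u @ \<pi> ! i # v @ [Suc (length (u @ \<pi> ! i # v))]"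
      using subperm_append[of \<pi>] uv(1) by (metis append.assoc append_Cons)
    show ?thesis
    proof (rule not_pattern_class_bubble_preimage[OF perm uv(2) _ uv(4) ij(6) contains])
      fix w m assume "\<And>y. y \<in> set w \<Longrightarrow> y < m" "\<pi> \<preceq> w @ [m]"
      then show "u @ \<pi> ! i # v \<preceq> w"
        using subperm_snoc_max max uv(1) by metis
    qed (use uv(3) in blast)
  qed
qed

end
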